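(* Let $p\ge2$ and consider the hypergeometric weights and the Gauss--Borel factorization $\mathscr M=S^{-1}H\tilde S^{-\top}$ described in the context. Fix $a\ne m$ in $\{1,\dots,p\}$, $r\in\{1,\dots,M^{(a)}\}$, $q\in\{1,\dots,M^{(m)}\}$, $s\in\{1,\dots,N\}$. Let $\hat\Theta$, $\check\Theta$, $\Theta_s$ denote the parameter shifts $b_r^{(a)}\to b_r^{(a)}+1$, $b_q^{(m)}\to b_q^{(m)}+1$, $c_s\to c_s-1$, respectively (all other parameters fixed), and define the connection matrices $$\Omega^{(r)}=S(\hat\Theta S)^{-1},\qquad \Omega^{(q)}=S(\check\Theta S)^{-1},\qquad \Omega^{(s)}=S(\Theta_sS)^{-1}.$$ Then $$\Omega^{(s)}\,(\Theta_s\Omega^{(r)})=\Omega^{(r)}\,(\hat\Theta\Omega^{(s)}),$$ $$\Omega^{(s)}\,(\Theta_s\Omega^{(q)})=\Omega^{(q)}\,(\check\Theta\Omega^{(s)}),$$ $$\Omega^{(r)}\,(\hat\Theta\Omega^{(q)})=\Omega^{(q)}\,(\check\Theta\Omega^{(r)}).$$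
   Context: All semi-infinite matrices are indexed from $0$. Weights: $w^{(a)}(k)=\frac{(b_1^{(a)})_k\cdots(b_{M^{(a)}}^{(a)})_k}{(c_1)_k\cdots(c_N)_k}\frac{(\eta^{(a)})^k}{k!}$, $k\in\mathbb N_0$, $a\in\{1,\dots,p\}$; the parameters are such that the weights are well defined and all moments $\rho^{(a)}_m=\sum_{k\ge0}k^mw^{(a)}(k)$ converge absolutely. Moment matrix: $\mathscr M_{n,pl+a-1}=\rho^{(a)}_{n+l}$ for $n,l\in\mathbb N_0$, $a\in\{1,\dots,p\}$. It is assumed that all leading principal minors of $\mathscr M$ are nonzero (for the original parameters and for all shifted parameters involved), so that there is a unique Gauss--Borel factorization $\mathscr M=S^{-1}H\tilde S^{-\top}$ with $S,\tilde S$ lower unitriangular and $H$ diagonal. For any quantity $Q$ depending on the parameters and any parameter shift $\Theta$, $\Theta Q$ denotes $Q$ evaluated at the shifted parameters. *)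

theory Defs
  imports Complex_Main "Jordan_Normal_Form.Determinant"
begin

type_synonym smat = "nat \<Rightarrow> nat \<Rightarrow> complex"

(* The entries are series; for the products formed below (triangular and diagonal factors)
   every series has only finitely many nonzero terms. *)
definition smat_mult :: "smat \<Rightarrow> smat \<Rightarrow> smat" (infixl "\<star>" 70) where
  "A \<star> B = (\<lambda>i j. \<Sum>k. A i k * B k j)"

definition smat_one :: smat where
  "smat_one = (\<lambda>i j. if i = j then 1 else 0)"

definition smat_transpose :: "smat \<Rightarrow> smat" where
  "smat_transpose A = (\<lambda>i j. A j i)"

definition smat_diagonal :: "smat \<Rightarrow> bool" where
  "smat_diagonal A \<longleftrightarrow> (\<forall>i j. i \<noteq> j \<longrightarrow> A i j = 0)"

definition lower_unitriangular :: "smat \<Rightarrow> bool" where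
  "lower_unitriangular A \<longleftrightarrow> (\<forall>i. A i i = 1) \<and> (\<forall>i j. i < j \<longrightarrow> A i j = 0)"

(* Only ever applied to lower unitriangular matrices. These form a group, whereas the inverse
   of a general semi-infinite matrix need not be unique; hence the inverse is taken there. *)
definition smat_inv :: "smat \<Rightarrow> smat" where
  "smat_inv A = (THE B. lower_unitriangular B \<and> A \<star> B = smat_one \<and> B \<star> A = smat_one)"

definition leading_minor :: "smat \<Rightarrow> nat \<Rightarrow> complex" where
  "leading_minor A n = det (mat n n (\<lambda>(i, j). A i j))"

definition gauss_borel :: "smat \<Rightarrow> smat \<Rightarrow> smat \<Rightarrow> smat \<Rightarrow> bool" where
  "gauss_borel A S H T \<longleftrightarrow>
     lower_unitriangular S \<and> smat_diagonal H \<and> lower_unitriangular T \<and>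
     A = smat_inv S \<star> H \<star> smat_transpose (smat_inv T)"

(* num_w is p, num_b a is M^(a), num_c is N; par_b a i is b_i^(a). All three kinds of
   indices start at 1; values of the functions outside the index ranges are irrelevant. *)
record hyp_params =
  num_w :: nat
  num_b :: "nat \<Rightarrow> nat"
  num_c :: nat
  par_b :: "nat \<Rightarrow> nat \<Rightarrow> complex"
  par_c :: "nat \<Rightarrow> complex"
  par_eta :: "nat \<Rightarrow> complex"

definition weight :: "hyp_params \<Rightarrow> nat \<Rightarrow> nat \<Rightarrow> complex" where
  "weight \<theta> a k =
     (\<Prod>i = 1..num_b \<theta> a. pochhammer (par_b \<theta> a i) k) / (\<Prod>j = 1..num_c \<theta>. pochhammer (par_c \<theta> j) k)
       * (par_eta \<theta> a ^ k / fact k)"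

definition moment :: "hyp_params \<Rightarrow> nat \<Rightarrow> nat \<Rightarrow> complex" where
  "moment \<theta> a n = (\<Sum>k. of_nat k ^ n * weight \<theta> a k)"

definition weights_well_defined :: "hyp_params \<Rightarrow> bool" where
  "weights_well_defined \<theta> \<longleftrightarrow> (\<forall>j \<in> {1..num_c \<theta>}. \<forall>k. pochhammer (par_c \<theta> j) k \<noteq> 0)"

definition moments_abs_convergent :: "hyp_params \<Rightarrow> bool" where
  "moments_abs_convergent \<theta> \<longleftrightarrow>
     (\<forall>a \<in> {1..num_w \<theta>}. \<forall>n. summable (\<lambda>k. norm (of_nat k ^ n * weight \<theta> a k)))"

(* Column j = p l + a - 1 with a in {1..p} means l = j div p and a = j mod p + 1. *)
definition moment_matrix :: "hyp_params \<Rightarrow> smat" where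
  "moment_matrix \<theta> = (\<lambda>n j. moment \<theta> (j mod num_w \<theta> + 1) (n + j div num_w \<theta>))"

definition admissible :: "hyp_params \<Rightarrow> bool" where
  "admissible \<theta> \<longleftrightarrow> weights_well_defined \<theta> \<and> moments_abs_convergent \<theta> \<and>
     (\<forall>n. leading_minor (moment_matrix \<theta>) n \<noteq> 0)"

(* For admissible parameters the factorization exists and is unique. *)
definition gb_S :: "hyp_params \<Rightarrow> smat" where
  "gb_S \<theta> = (THE S. \<exists>H T. gauss_borel (moment_matrix \<theta>) S H T)"

definition shift_b :: "nat \<Rightarrow> nat \<Rightarrow> hyp_params \<Rightarrow> hyp_params" where
  "shift_b a r \<theta> = \<theta>\<lparr>par_b := (par_b \<theta>)(a := (par_b \<theta> a)(r := par_b \<theta> a r + 1))\<rparr>"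

definition shift_c :: "nat \<Rightarrow> hyp_params \<Rightarrow> hyp_params" where
  "shift_c s \<theta> = \<theta>\<lparr>par_c := (par_c \<theta>)(s := par_c \<theta> s - 1)\<rparr>"

definition shifted :: "(hyp_params \<Rightarrow> hyp_params) \<Rightarrow> (hyp_params \<Rightarrow> 'q) \<Rightarrow> hyp_params \<Rightarrow> 'q" where
  "shifted \<Theta> Q = (\<lambda>\<theta>. Q (\<Theta> \<theta>))"

definition connection :: "(hyp_params \<Rightarrow> hyp_params) \<Rightarrow> hyp_params \<Rightarrow> smat" where
  "connection \<Theta> \<theta> = gb_S \<theta> \<star> smat_inv (shifted \<Theta> gb_S \<theta>)"

end

theory Submission imports Defs begin

text \<open>
  Row \<open>n\<close> of \<open>S\<close> is determined by the condition that \<open>S \<star> \<M>\<close> is upper triangular, which is a linear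
  system whose matrix is the \<open>n\<close>-th leading block of the moment matrix. Hence \<open>S\<close> is a well-defined
  lower unitriangular matrix for admissible parameters, and for commuting shifts both sides of each
  identity telescope in the associative group of lower unitriangular matrices: writing \<open>\<Theta>\<close>, \<open>\<Psi>\<close> for the
  shifts, both are \<open>S\<close> times the inverse of \<open>\<Theta>\<Psi>S\<close>.
\<close>

section \<open>Algebra of lower triangular semi-infinite matrices\<close>

definition lower_triangular :: "smat \<Rightarrow> bool" where
  "lower_triangular A \<longleftrightarrow> (\<forall>i j. i < j \<longrightarrow> A i j = 0)"

lemma lower_unitriangular_imp_lower_triangular:
  "lower_unitriangular A \<Longrightarrow> lower_triangular A"
  by (simp add: lower_unitriangular_def lower_triangular_def)

lemma smat_diagonal_imp_lower_triangular:
  "smat_diagonal A \<Longrightarrow> lower_triangular A"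
  by (simp add: smat_diagonal_def lower_triangular_def)

lemma lower_triangular_one: "lower_triangular smat_one"
  by (simp add: lower_triangular_def smat_one_def)

text \<open>Row \<open>i\<close> of \<open>A\<close> vanishes beyond column \<open>i\<close>, so the
  series is a finite sum. \<open>B\<close> stays arbitrary so that the moment matrix can be a right
  factor.\<close>

lemma smat_mult_lower_triangular:
  assumes "lower_triangular A"
  shows "(A \<star> B) i j = (\<Sum>k\<le>i. A i k * B k j)"
  unfolding smat_mult_def
  using assms by (intro suminf_finite) (auto simp: lower_triangular_def)

lemma lower_triangular_mult:
  assumes "lower_triangular A" "lower_triangular B"
  shows "lower_triangular (A \<star> B)"
  unfolding lower_triangular_def smat_mult_lower_triangular[OF assms(1)]
  using assms(2) by (auto simp: lower_triangular_def intro!: sum.neutral)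

lemma lower_unitriangular_mult:
  assumes "lower_unitriangular A" "lower_unitriangular B"
  shows "lower_unitriangular (A \<star> B)"
proof -
  note tri = assms[THEN lower_unitriangular_imp_lower_triangular]
  have "(A \<star> B) i i = 1" for i
  proof -
    have "(\<Sum>k<i. A i k * B k i) = 0"
      using assms(2) by (intro sum.neutral) (auto simp: lower_unitriangular_def)
    with assms show ?thesis
      by (simp add: smat_mult_lower_triangular[OF tri(1)] lower_unitriangular_def
          lessThan_Suc_atMost[symmetric])
  qed
  with lower_triangular_mult[OF tri] show ?thesis
    by (simp add: lower_unitriangular_def lower_triangular_def)
qed

text \<open>Triangularity of the two left factors makes all sums finite, so their order may be
  exchanged. The last factor is free, as needed for full or upper triangular matrices.\<close>

lemma smat_mult_assoc:
  assumes A: "lower_triangular A" and B: "lower_triangular B"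
  shows "(A \<star> B) \<star> C = A \<star> (B \<star> C)"
proof (intro ext)
  fix i j
  have "((A \<star> B) \<star> C) i j = (\<Sum>l\<le>i. \<Sum>k\<le>i. A i k * B k l * C l j)"
    by (simp add: smat_mult_lower_triangular[OF lower_triangular_mult[OF A B]]
        smat_mult_lower_triangular[OF A] sum_distrib_right)
  also have "\<dots> = (\<Sum>k\<le>i. \<Sum>l\<le>i. A i k * B k l * C l j)"
    by (rule sum.swap)
  \<comment> \<open>The terms with \<open>k < l\<close> drop out because \<open>B\<close> is lower
    triangular.\<close>
  also have "\<dots> = (\<Sum>k\<le>i. \<Sum>l\<le>k. A i k * B k l * C l j)"
    using B by (intro sum.cong sum.mono_neutral_right) (auto simp: lower_triangular_def)
  also have "\<dots> = (A \<star> (B \<star> C)) i j"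
    by (simp add: smat_mult_lower_triangular[OF A] smat_mult_lower_triangular[OF B]
        sum_distrib_left mult.assoc)
  finally show "((A \<star> B) \<star> C) i j = (A \<star> (B \<star> C)) i j" .
qed

lemma smat_one_mult [simp]: "smat_one \<star> A = A"
proof (intro ext)
  fix i j
  have "(smat_one \<star> A) i j = (\<Sum>k\<le>i. if i = k then A k j else 0)"
    unfolding smat_mult_lower_triangular[OF lower_triangular_one]
    by (intro sum.cong) (auto simp: smat_one_def)
  then show "(smat_one \<star> A) i j = A i j" by simp
qed

lemma smat_mult_one:
  assumes "lower_triangular A"
  shows "A \<star> smat_one = A"
proof (intro ext)
  fix i j
  have "(A \<star> smat_one) i j = (\<Sum>k\<le>i. if k = j then A i k else 0)"
    unfolding smat_mult_lower_triangular[OF assms]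
    by (intro sum.cong) (auto simp: smat_one_def)
  then show "(A \<star> smat_one) i j = A i j"
    using assms by (auto simp: lower_triangular_def not_le)
qed

section \<open>Inverses of lower unitriangular matrices\<close>

text \<open>This solves \<open>A \<star> X = smat_one\<close> row by row for \<open>A\<close> with
  unit diagonal, so no division occurs.\<close>

fun forward_subst :: "smat \<Rightarrow> nat \<Rightarrow> nat \<Rightarrow> complex" where
  "forward_subst A i j = smat_one i j - (\<Sum>k<i. A i k * forward_subst A k j)"

declare forward_subst.simps [simp del]

lemma forward_subst_above_diagonal:
  "i < j \<Longrightarrow> forward_subst A i j = 0"
proof (induction i rule: less_induct)
  case (less i)
  then show ?case
    by (subst forward_subst.simps) (auto simp: smat_one_def intro!: sum.neutral)
qed

lemma lower_unitriangular_forward_subst: "lower_unitriangular (forward_subst A)"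
proof -
  have "forward_subst A i i = 1" for i
    by (subst forward_subst.simps) (simp add: smat_one_def forward_subst_above_diagonal)
  then show ?thesis
    by (simp add: lower_unitriangular_def forward_subst_above_diagonal)
qed

lemma mult_forward_subst:
  assumes "lower_unitriangular A"
  shows "A \<star> forward_subst A = smat_one"
proof (intro ext)
  fix i j
  have "(A \<star> forward_subst A) i j = (\<Sum>k<i. A i k * forward_subst A k j) + forward_subst A i j"
    using assms
    by (simp add: smat_mult_lower_triangular lower_unitriangular_imp_lower_triangular
        lessThan_Suc_atMost[symmetric] lower_unitriangular_def)
  then show "(A \<star> forward_subst A) i j = smat_one i j"
    by (simp add: forward_subst.simps[of A i j])
qed

text \<open>The usual group argument: the right inverse \<open>B\<close> of \<open>A\<close> has a
  right inverse \<open>C\<close> of its own, and associativity forces \<open>C = A\<close>.\<close>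

lemma forward_subst_mult:
  assumes "lower_unitriangular A"
  shows "forward_subst A \<star> A = smat_one"
proof -
  define B where "B = forward_subst A"
  define C where "C = forward_subst B"
  have A: "lower_triangular A" and B: "lower_unitriangular B"
    using assms by (simp_all add: lower_unitriangular_imp_lower_triangular B_def
        lower_unitriangular_forward_subst)
  have "A = A \<star> (B \<star> C)"
    using mult_forward_subst[OF B] A by (simp add: C_def smat_mult_one)
  also have "\<dots> = (A \<star> B) \<star> C"
    using A B by (simp add: smat_mult_assoc lower_unitriangular_imp_lower_triangular)
  also have "\<dots> = C"
    using mult_forward_subst[OF assms] by (simp add: B_def)
  finally have "C = A" ..
  with mult_forward_subst[OF B] have "B \<star> A = smat_one"
    by (simp add: C_def)
  then show ?thesis by (simp add: B_def)
qed

lemma smat_inv_unique: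
  assumes A: "lower_unitriangular A" and B: "lower_unitriangular B"
    and AB: "A \<star> B = smat_one" and BA: "B \<star> A = smat_one"
  shows "smat_inv A = B"
  unfolding smat_inv_def
proof (rule the_equality)
  show "lower_unitriangular B \<and> A \<star> B = smat_one \<and> B \<star> A = smat_one"
    using assms by simp
next
  fix C assume C: "lower_unitriangular C \<and> A \<star> C = smat_one \<and> C \<star> A = smat_one"
  then have "C = (B \<star> A) \<star> C" by (simp add: BA)
  also have "\<dots> = B \<star> (A \<star> C)"
    using A B by (simp add: smat_mult_assoc lower_unitriangular_imp_lower_triangular)
  also have "\<dots> = B"
    using B C by (simp add: smat_mult_one lower_unitriangular_imp_lower_triangular)
  finally show "C = B" .
qed

lemma smat_inv_eq_forward_subst:
  "lower_unitriangular A \<Longrightarrow> smat_inv A = forward_subst A"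
  by (intro smat_inv_unique lower_unitriangular_forward_subst mult_forward_subst forward_subst_mult)

lemma lower_unitriangular_smat_inv:
  "lower_unitriangular A \<Longrightarrow> lower_unitriangular (smat_inv A)"
  by (simp add: smat_inv_eq_forward_subst lower_unitriangular_forward_subst)

lemma smat_inv_right: "lower_unitriangular A \<Longrightarrow> A \<star> smat_inv A = smat_one"
  by (simp add: smat_inv_eq_forward_subst mult_forward_subst)

lemma smat_inv_left: "lower_unitriangular A \<Longrightarrow> smat_inv A \<star> A = smat_one"
  by (simp add: smat_inv_eq_forward_subst forward_subst_mult)

lemma smat_inv_inv: "lower_unitriangular A \<Longrightarrow> smat_inv (smat_inv A) = A"
  by (intro smat_inv_unique lower_unitriangular_smat_inv smat_inv_left smat_inv_right)

section \<open>Linear systems with a leading block as matrix\<close>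

text \<open>A nonzero determinant makes the block a unit in the matrix ring. Its inverse is restated
  with plain sums to fit \<open>smat\<close>.\<close>

lemma leading_minor_inverse:
  assumes "leading_minor A n \<noteq> 0"
  obtains B where
    "\<And>i j. i < n \<Longrightarrow> j < n \<Longrightarrow> (\<Sum>k<n. A i k * B k j) = (if i = j then 1 else 0)"
    "\<And>i j. i < n \<Longrightarrow> j < n \<Longrightarrow> (\<Sum>k<n. B i k * A k j) = (if i = j then 1 else 0)"
proof -
  define M where "M = mat n n (\<lambda>(i, j). A i j)"
  have M: "M \<in> carrier_mat n n" by (simp add: M_def)
  obtain N where N: "N \<in> carrier_mat n n" and NM: "N * M = 1\<^sub>m n" and MN: "M * N = 1\<^sub>m n"
    using det_non_zero_imp_unit[OF M, of n] assms
    by (auto simp: leading_minor_def M_def Units_def ring_mat_def)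
  show thesis
  proof (rule that[of "\<lambda>i j. N $$ (i, j)"])
    fix i j assume ij: "i < n" "j < n"
    have "(M * N) $$ (i, j) = (\<Sum>k<n. A i k * N $$ (k, j))"
      using ij N by (auto simp: M_def scalar_prod_def lessThan_atLeast0 intro!: sum.cong)
    then show "(\<Sum>k<n. A i k * N $$ (k, j)) = (if i = j then 1 else 0)"
      using ij by (simp add: MN)
    have "(N * M) $$ (i, j) = (\<Sum>k<n. N $$ (i, k) * A k j)"
      using ij N by (auto simp: M_def scalar_prod_def lessThan_atLeast0 intro!: sum.cong)
    then show "(\<Sum>k<n. N $$ (i, k) * A k j) = (if i = j then 1 else 0)"
      using ij by (simp add: NM)
  qed
qed

lemma leading_minor_solve:
  assumes "leading_minor A n \<noteq> 0"
  shows "\<exists>v. \<forall>j<n. (\<Sum>k<n. v k * A k j) = w j"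
proof -
  obtain B where B:
    "\<And>i j. i < n \<Longrightarrow> j < n \<Longrightarrow> (\<Sum>k<n. B i k * A k j) = (if i = j then 1 else 0)"
    using leading_minor_inverse[OF assms] by metis
  \<comment> \<open>The solution is the row vector \<open>w\<close> times the inverse block
    \<open>B\<close>.\<close>
  have "(\<Sum>k<n. (\<Sum>i<n. w i * B i k) * A k j) = w j" if "j < n" for j
  proof -
    have "(\<Sum>k<n. (\<Sum>i<n. w i * B i k) * A k j) = (\<Sum>k<n. \<Sum>i<n. w i * (B i k * A k j))"
      by (simp add: sum_distrib_right mult.assoc)
    also have "\<dots> = (\<Sum>i<n. w i * (\<Sum>k<n. B i k * A k j))"
      by (subst sum.swap) (simp add: sum_distrib_left)
    also have "\<dots> = (\<Sum>i<n. if i = j then w i else 0)"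
      using that by (intro sum.cong) (auto simp: B)
    finally show ?thesis using that by simp
  qed
  then show ?thesis by (intro exI[of _ "\<lambda>k. \<Sum>i<n. w i * B i k"]) simp
qed

lemma leading_minor_left_kernel:
  assumes "leading_minor A n \<noteq> 0" and v: "\<And>j. j < n \<Longrightarrow> (\<Sum>k<n. v k * A k j) = 0"
    and "i < n"
  shows "v i = 0"
proof -
  obtain B where B:
    "\<And>i j. i < n \<Longrightarrow> j < n \<Longrightarrow> (\<Sum>k<n. A i k * B k j) = (if i = j then 1 else 0)"
    using leading_minor_inverse[OF assms(1)] by metis
  have "0 = (\<Sum>j<n. (\<Sum>k<n. v k * A k j) * B j i)"
    by (simp add: v)
  also have "\<dots> = (\<Sum>j<n. \<Sum>k<n. v k * (A k j * B j i))"
    by (simp add: sum_distrib_right mult.assoc)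
  also have "\<dots> = (\<Sum>k<n. v k * (\<Sum>j<n. A k j * B j i))"
    by (subst sum.swap) (simp add: sum_distrib_left)
  also have "\<dots> = (\<Sum>k<n. if k = i then v k else 0)"
    using \<open>i < n\<close> by (intro sum.cong) (auto simp: B)
  finally show ?thesis using \<open>i < n\<close> by simp
qed

section \<open>Existence and uniqueness of the Gauss--Borel factorization\<close>

text \<open>Cancelling \<open>smat_inv S\<close> leaves a diagonal matrix times the transpose of a
  lower unitriangular one.\<close>

lemma gauss_borel_below_diagonal:
  assumes gb: "gauss_borel A S H T" and "j < n"
  shows "(S \<star> A) n j = 0"
proof -
  define U where "U = smat_transpose (smat_inv T)"
  have S: "lower_unitriangular S" and H: "smat_diagonal H" and T: "lower_unitriangular T"
    and A: "A = smat_inv S \<star> H \<star> U"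
    using gb by (auto simp: gauss_borel_def U_def)
  note [simp] = S H lower_unitriangular_imp_lower_triangular lower_unitriangular_smat_inv
    smat_diagonal_imp_lower_triangular lower_triangular_mult
  \<comment> \<open>\<open>U\<close> is upper triangular and is kept as the last factor, where
    \<open>smat_mult_assoc\<close> allows any matrix.\<close>
  have "S \<star> A = (S \<star> (smat_inv S \<star> H)) \<star> U"
    by (simp add: A smat_mult_assoc)
  also have "S \<star> (smat_inv S \<star> H) = H"
    by (simp add: smat_mult_assoc[symmetric] smat_inv_right)
  finally have "S \<star> A = H \<star> U" .
  then have "(S \<star> A) n j = (\<Sum>k\<le>n. H n k * U k j)"
    by (simp only: smat_mult_lower_triangular[OF smat_diagonal_imp_lower_triangular[OF H]])
  also have "\<dots> = 0"
  proof (intro sum.neutral ballI)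
    fix k
    show "H n k * U k j = 0"
    proof (cases "k = n")
      case True
      then show ?thesis
        using lower_unitriangular_smat_inv[OF T] \<open>j < n\<close>
        by (simp add: U_def smat_transpose_def lower_unitriangular_def)
    qed (use H in \<open>simp add: smat_diagonal_def\<close>)
  qed
  finally show ?thesis .
qed

lemma gauss_borel_unique:
  assumes minors: "\<And>n. leading_minor A n \<noteq> 0"
    and gb: "gauss_borel A S H T" "gauss_borel A S' H' T'"
  shows "S = S'"
proof (intro ext)
  fix n i
  have S: "lower_unitriangular S" "lower_unitriangular S'"
    using gb by (auto simp: gauss_borel_def)
  show "S n i = S' n i"
  proof (cases "i < n")
    case True
    \<comment> \<open>The terms for \<open>k = n\<close> cancel, both diagonal entries being 1, so
      only the block of size \<open>n\<close> remains.\<close>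
    have "(\<Sum>k<n. (S n k - S' n k) * A k j) = 0" if "j < n" for j
    proof -
      have "(S \<star> A) n j - (S' \<star> A) n j = 0"
        using gb[THEN gauss_borel_below_diagonal, OF that] by simp
      then show ?thesis
        using S by (simp add: smat_mult_lower_triangular lower_unitriangular_imp_lower_triangular
            lessThan_Suc_atMost[symmetric] lower_unitriangular_def left_diff_distrib
            sum_subtractf)
    qed
    from leading_minor_left_kernel[OF minors this True] show ?thesis by simp
  next
    case False
    then show ?thesis
      using S by (cases "i = n") (auto simp: lower_unitriangular_def)
  qed
qed

lemma gauss_borel_exists:
  assumes minors: "\<And>n. leading_minor A n \<noteq> 0"
  obtains S H T where "gauss_borel A S H T"
proof -
  \<comment> \<open>The vector \<open>v\<close> holds the entries of row \<open>n\<close> of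
    \<open>S\<close> left of the diagonal; the right-hand side is the contribution of the diagonal
    entry 1.\<close>
  have "\<forall>n. \<exists>v. \<forall>j<n. (\<Sum>k<n. v k * A k j) = - A n j"
    using minors by (intro allI leading_minor_solve)
  then obtain v where v: "\<And>n j. j < n \<Longrightarrow> (\<Sum>k<n. v n k * A k j) = - A n j"
    by metis
  define S :: smat where "S = (\<lambda>n k. if k < n then v n k else if k = n then 1 else 0)"
  have S: "lower_unitriangular S"
    by (simp add: S_def lower_unitriangular_def)
  define B where "B = S \<star> A"
  have B_sum: "B n j = (\<Sum>k<Suc n. S n k * A k j)" for n j
    using S by (simp only: B_def smat_mult_lower_triangular
        lower_unitriangular_imp_lower_triangular lessThan_Suc_atMost)
  have B_low: "B n j = 0" if "j < n" for n j
    using v[OF that] by (simp add: B_sum S_def)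
  \<comment> \<open>Otherwise row \<open>n\<close> of \<open>S\<close> would lie in the left kernel of the leading block of size \<open>n + 1\<close>.\<close>
  have B_diag: "B n n \<noteq> 0" for n
  proof
    assume "B n n = 0"
    then have "(\<Sum>k<Suc n. S n k * A k j) = 0" if "j < Suc n" for j
      unfolding B_sum[symmetric] using that B_low[of j n] by (cases "j = n") simp_all
    from leading_minor_left_kernel[OF minors this, of n] show False
      by (simp add: S_def)
  qed
  \<comment> \<open>The upper triangular \<open>B\<close> splits into its diagonal \<open>H\<close>
    and a unitriangular factor, obtained by dividing each row by its pivot; \<open>V\<close> is the
    transpose of that factor.\<close>
  define H :: smat where "H = (\<lambda>i j. if i = j then B i i else 0)"
  define V :: smat where "V = (\<lambda>i j. B j i / B j j)"
  have H: "smat_diagonal H"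
    by (simp add: H_def smat_diagonal_def)
  have V: "lower_unitriangular V"
    using B_diag B_low by (simp add: V_def lower_unitriangular_def)
  note [simp] = S H lower_unitriangular_imp_lower_triangular lower_unitriangular_smat_inv
    smat_diagonal_imp_lower_triangular lower_triangular_mult
  have HV: "H \<star> smat_transpose V = B"
  proof (intro ext)
    fix i j
    have "(H \<star> smat_transpose V) i j = (\<Sum>k\<le>i. if k = i then B i j else 0)"
      using B_diag unfolding smat_mult_lower_triangular[OF smat_diagonal_imp_lower_triangular[OF H]]
      by (intro sum.cong) (auto simp: H_def V_def smat_transpose_def)
    then show "(H \<star> smat_transpose V) i j = B i j" by simp
  qed
  have "A = (smat_inv S \<star> S) \<star> A"
    by (simp add: smat_inv_left)
  also have "\<dots> = smat_inv S \<star> (H \<star> smat_transpose V)"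
    by (simp add: smat_mult_assoc HV B_def)
  \<comment> \<open>The factorization contains the inverse of \<open>T\<close>, so \<open>T\<close>
    is taken to be \<open>smat_inv V\<close>.\<close>
  also have "\<dots> = smat_inv S \<star> H \<star> smat_transpose (smat_inv (smat_inv V))"
    using V by (simp add: smat_mult_assoc smat_inv_inv)
  finally have "gauss_borel A S H (smat_inv V)"
    using V by (simp add: gauss_borel_def)
  then show thesis by (rule that)
qed

text \<open>Existence and uniqueness together ensure that the definite description in
  \<open>gb_S\<close> denotes the actual factor.\<close>

lemma lower_unitriangular_gb_S:
  assumes "admissible \<theta>"
  shows "lower_unitriangular (gb_S \<theta>)"
proof -
  have minors: "leading_minor (moment_matrix \<theta>) n \<noteq> 0" for n
    using assms by (simp add: admissible_def)
  obtain S H T where gb: "gauss_borel (moment_matrix \<theta>) S H T"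
    using gauss_borel_exists[OF minors] .
  then have "gb_S \<theta> = S"
    unfolding gb_S_def using gauss_borel_unique[OF minors] by blast
  with gb show ?thesis by (simp add: gauss_borel_def)
qed

section \<open>Connection matrices and commuting shifts\<close>

lemma connection_mult_shifted_connection:
  assumes "admissible \<theta>" "admissible (\<Theta> \<theta>)" "admissible (\<Psi> (\<Theta> \<theta>))"
  shows "connection \<Theta> \<theta> \<star> shifted \<Theta> (connection \<Psi>) \<theta> = gb_S \<theta> \<star> smat_inv (gb_S (\<Psi> (\<Theta> \<theta>)))"
proof -
  note S = assms[THEN lower_unitriangular_gb_S]
  note [simp] = S lower_unitriangular_imp_lower_triangular lower_unitriangular_smat_inv
    lower_triangular_mult
  let ?S = "gb_S \<theta>" and ?S1 = "gb_S (\<Theta> \<theta>)" and ?S2 = "gb_S (\<Psi> (\<Theta> \<theta>))"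
  have "(?S \<star> smat_inv ?S1) \<star> (?S1 \<star> smat_inv ?S2) = ?S \<star> ((smat_inv ?S1 \<star> ?S1) \<star> smat_inv ?S2)"
    by (simp add: smat_mult_assoc)
  then show ?thesis
    by (simp add: connection_def shifted_def smat_inv_left)
qed

text \<open>The telescoped product depends only on the initial and the doubly shifted parameters,
  which agree for both orders.\<close>

lemma connection_commute:
  assumes "\<Psi> (\<Theta> \<theta>) = \<Theta> (\<Psi> \<theta>)"
    and "admissible \<theta>" "admissible (\<Theta> \<theta>)" "admissible (\<Psi> \<theta>)" "admissible (\<Psi> (\<Theta> \<theta>))"
  shows "connection \<Theta> \<theta> \<star> shifted \<Theta> (connection \<Psi>) \<theta> = connection \<Psi> \<theta> \<star> shifted \<Psi> (connection \<Theta>) \<theta>"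
  using connection_mult_shifted_connection[of \<theta> \<Theta> \<Psi>]
    connection_mult_shifted_connection[of \<theta> \<Psi> \<Theta>] assms by simp

lemma shift_b_shift_c: "shift_b a r (shift_c s \<theta>) = shift_c s (shift_b a r \<theta>)"
  by (simp add: shift_b_def shift_c_def)

lemma shift_b_shift_b:
  "a \<noteq> m \<Longrightarrow> shift_b a r (shift_b m q \<theta>) = shift_b m q (shift_b a r \<theta>)"
  by (simp add: shift_b_def fun_upd_twist)

theorem lemma3p14:
  fixes \<theta> :: hyp_params and a m r q s :: nat
  assumes "num_w \<theta> \<ge> 2"
    and "a \<in> {1..num_w \<theta>}" and "m \<in> {1..num_w \<theta>}" and "a \<noteq> m"
    and "r \<in> {1..num_b \<theta> a}" and "q \<in> {1..num_b \<theta> m}" and "s \<in> {1..num_c \<theta>}"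
    and "admissible \<theta>"
    and "admissible (shift_b a r \<theta>)"
    and "admissible (shift_b m q \<theta>)"
    and "admissible (shift_c s \<theta>)"
    and "admissible (shift_b a r (shift_c s \<theta>))"
    and "admissible (shift_b m q (shift_c s \<theta>))"
    and "admissible (shift_b a r (shift_b m q \<theta>))"
  shows "
         connection (shift_c s) \<theta> \<star> shifted (shift_c s) (connection (shift_b a r)) \<theta>
           = connection (shift_b a r) \<theta> \<star> shifted (shift_b a r) (connection (shift_c s)) \<theta> \<and>
         connection (shift_c s) \<theta> \<star> shifted (shift_c s) (connection (shift_b m q)) \<theta>
           = connection (shift_b m q) \<theta> \<star> shifted (shift_b m q) (connection (shift_c s)) \<theta> \<and>
         connection (shift_b a r) \<theta> \<star> shifted (shift_b a r) (connection (shift_b m q)) \<theta>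
           = connection (shift_b m q) \<theta> \<star> shifted (shift_b m q) (connection (shift_b a r)) \<theta>"
  \<comment> \<open>Each double shift is assumed admissible in one order; the commutation rules
    carry this over to the other.\<close>
  using assms by (intro conjI connection_commute) (simp_all add: shift_b_shift_c shift_b_shift_b)

end
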